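(* Let $a,b$ be positive integers and let $p_{a\times b}$ be the $a\times b$ rectangular polyomino. Then the set $\mathcal{L}=\{p_{a\times b}\}$ is $n$-Noetherian for every $n\in\mathbb{N}$.
   Context: A polyomino is a region of $\mathbb{R}^2$ made of unit squares joined along coincident edges, considered up to translation; $p_{a\times b}$ is the rectangle of height $a$ and width $b$. $R_{n\times m}$ denotes the rectangular region of height $n$ and width $m$. A tiling of $R_{n\times m}$ by a multiset $T$ of polyominoes is a placement of all elements of $T$ in $R_{n\times m}$ covering every point, with no two different elements having two-dimensional overlap; a tiling by elements of $\mathcal{L}$ is a tiling by a multiset with elements drawn from $\mathcal{L}$. In this result all translations, reflections and rotations of the $a\times b$ polyomino are allowed. A rearrangement with rotations of a tiling of $R_{n\times m}$ by $T$ is any tiling of $R_{n\times m}$ by a multiset obtained from $T$ by replacing any of its elements by rotated copies (independently of each other). A tiling of $R_{n\times m}$ admits a subtiling allowing rotations if it has a rearrangement with rotations which is the side-by-side juxtaposition of a tiling of $R_{n\times m'}$ and a tiling of $R_{n\times m''}$ with $m=m'+m''$ and $m',m''\neq 0$. $\beta^R_n(\mathcal{L})$ is the smallest natural number such that every tiling of $R_{n\times m}$ by elements of $\mathcal{L}$ with $m>\beta^R_n(\mathcal{L})$ admits a subtiling allowing rotations; $\beta^R_n(\mathcal{L}):=\infty$ if there are tilings with $m$ arbitrarily large admitting no such subtiling. $\mathcal{L}$ is called $n$-Noetherian if $\beta^R_n(\mathcal{L})<\infty$. *)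

theory Defs
  imports "HOL-Analysis.Analysis" "HOL-Library.Multiset" "HOL-Library.Extended_Nat"
begin

(* A point is (x, y) with x horizontal and y vertical. *)
type_synonym region = "(real \<times> real) set"

definition unit_square :: "int \<times> int \<Rightarrow> region" where
  "unit_square c = cbox (of_int (fst c), of_int (snd c)) (of_int (fst c) + 1, of_int (snd c) + 1)"

definition edge_adjacent :: "int \<times> int \<Rightarrow> int \<times> int \<Rightarrow> bool" where
  "edge_adjacent c d \<longleftrightarrow> \<bar>fst c - fst d\<bar> + \<bar>snd c - snd d\<bar> = 1"

definition edge_connected :: "(int \<times> int) set \<Rightarrow> bool" where
  "edge_connected C \<longleftrightarrow>
     (\<forall>c\<in>C. \<forall>d\<in>C. (c, d) \<in> {(x, y). x \<in> C \<and> y \<in> C \<and> edge_adjacent x y}\<^sup>*)"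

(* A polyomino is a translation class of regions. We work with representatives, at arbitrary
   real positions, and compare them by translate_of; all notions below that concern a multiset
   T or a set L of polyominoes depend on their members only up to translation. *)
definition polyomino :: "region \<Rightarrow> bool" where
  "polyomino P \<longleftrightarrow>
     (\<exists>C v. finite C \<and> C \<noteq> {} \<and> edge_connected C \<and> P = (+) v ` (\<Union>c\<in>C. unit_square c))"

definition translate_of :: "region \<Rightarrow> region \<Rightarrow> bool" where
  "translate_of P Q \<longleftrightarrow> (\<exists>v. Q = (+) v ` P)"

(* Height h, width w: both the region R_{h x w} and a representative of p_{h x w}. *)
definition rect :: "nat \<Rightarrow> nat \<Rightarrow> region" where
  "rect h w = cbox (0, 0) (real w, real h)"

definition rot90 :: "real \<times> real \<Rightarrow> real \<times> real" where
  "rot90 p = (- snd p, fst p)"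

definition reflect :: "real \<times> real \<Rightarrow> real \<times> real" where
  "reflect p = (- fst p, snd p)"

definition rotated_copy :: "region \<Rightarrow> region \<Rightarrow> bool" where
  "rotated_copy P Q \<longleftrightarrow> (\<exists>k. translate_of ((rot90 ^^ k) ` P) Q)"

(* Every symmetry of the square is a rotation or a rotation after the reflection. *)
definition orientations :: "region set \<Rightarrow> region set" where
  "orientations L = {Q. \<exists>P\<in>L. \<exists>k. Q = (rot90 ^^ k) ` P \<or> Q = (rot90 ^^ k) ` (reflect ` P)}"

(* X is the set of placed tiles. A set suffices: two elements of T placed on the
   same region would overlap. *)
definition tiling :: "region \<Rightarrow> region multiset \<Rightarrow> region set \<Rightarrow> bool" where
  "tiling R T X \<longleftrightarrow>
     (\<forall>P\<in>#T. polyomino P) \<and>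
     finite X \<and> rel_mset translate_of T (mset_set X) \<and>
     \<Union>X = R \<and>
     pairwise (\<lambda>P Q. interior (P \<inter> Q) = {}) X"

definition drawn_from :: "region multiset \<Rightarrow> region set \<Rightarrow> bool" where
  "drawn_from T L \<longleftrightarrow> (\<forall>P\<in>#T. \<exists>Q\<in>L. translate_of Q P)"

definition rearrangement :: "region \<Rightarrow> region multiset \<Rightarrow> region set \<Rightarrow> bool" where
  "rearrangement R T Y \<longleftrightarrow> (\<exists>T'. rel_mset rotated_copy T T' \<and> tiling R T' Y)"

definition juxtaposed :: "nat \<Rightarrow> nat \<Rightarrow> nat \<Rightarrow> region set \<Rightarrow> bool" where
  "juxtaposed n m' m'' Y \<longleftrightarrow>
     (\<exists>T1 Y1 T2 Y2. tiling (rect n m') T1 Y1 \<and> tiling (rect n m'') T2 Y2 \<and>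
        Y = Y1 \<union> (\<lambda>P. (+) (real m', 0) ` P) ` Y2)"

(* Whether a tiling admits a subtiling depends only on its multiset T of tiles. *)
definition admits_subtiling :: "nat \<Rightarrow> nat \<Rightarrow> region multiset \<Rightarrow> bool" where
  "admits_subtiling n m T \<longleftrightarrow>
     (\<exists>Y m' m''. rearrangement (rect n m) T Y \<and>
        m = m' + m'' \<and> m' \<noteq> 0 \<and> m'' \<noteq> 0 \<and> juxtaposed n m' m'' Y)"

(* The infimum of the empty set in enat is infinity. *)
definition betaR :: "nat \<Rightarrow> region set \<Rightarrow> enat" where
  "betaR n L = Inf {enat N | N. \<forall>m>N. \<forall>T X.
     tiling (rect n m) T X \<and> drawn_from T L \<longrightarrow> admits_subtiling n m T}"

definition noetherian :: "nat \<Rightarrow> region set \<Rightarrow> bool" where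
  "noetherian n L \<longleftrightarrow> betaR n L < \<infinity>"


lemma edge_connected_grid:
  "edge_connected {c. 0 \<le> fst c \<and> fst c < int w \<and> 0 \<le> snd c \<and> snd c < int h}"
    (is "edge_connected ?C")
proof -
  let ?r = "{(x, y). x \<in> ?C \<and> y \<in> ?C \<and> edge_adjacent x y}"
  have sym: "sym (?r\<^sup>*)"
    by (rule sym_rtrancl) (auto simp: sym_def edge_adjacent_def abs_minus_commute)
  have horiz: "((0, j), (int i, j)) \<in> ?r\<^sup>*" if "i < w" "0 \<le> j" "j < int h" for i j
    using that
  proof (induction i)
    case (Suc i)
    then have "((int i, j), (int (Suc i), j)) \<in> ?r"
      by (auto simp: edge_adjacent_def)
    with Suc show ?case by (meson Suc_lessD rtrancl.rtrancl_into_rtrancl)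
  qed simp
  have vert: "((0, 0), (0, int j)) \<in> ?r\<^sup>*" if "0 < w" "j < h" for j
    using that
  proof (induction j)
    case (Suc j)
    then have "((0, int j), (0, int (Suc j))) \<in> ?r"
      by (auto simp: edge_adjacent_def)
    with Suc show ?case by (meson Suc_lessD rtrancl.rtrancl_into_rtrancl)
  qed simp
  have origin: "((0, 0), c) \<in> ?r\<^sup>*" if c: "c \<in> ?C" for c
  proof -
    obtain i j where ij: "c = (int i, int j)" "i < w" "j < h"
      using c by (cases c) (auto simp: dest!: zero_le_imp_eq_int)
    then have "0 < w" by simp
    then show ?thesis
      using rtrancl_trans[OF vert[OF _ ij(3)] horiz[OF ij(2)]] ij by simp
  qed
  show ?thesis
    unfolding edge_connected_def
    by (intro ballI) (rule rtrancl_trans[OF symD[OF sym origin] origin])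
qed

lemma unit_interval_cover:
  fixes x :: real
  assumes "0 < n" "0 \<le> x" "x \<le> real n"
  obtains i :: int where "0 \<le> i" "i < int n" "of_int i \<le> x" "x \<le> of_int i + 1"
proof (cases "x = real n")
  case True
  then show ?thesis using assms by (intro that[of "int n - 1"]) auto
next
  case False
  then have "\<lfloor>x\<rfloor> < int n" using assms by (simp add: floor_less_iff)
  then show ?thesis using assms by (intro that[of "\<lfloor>x\<rfloor>"]) linarith+
qed

lemma polyomino_rect:
  assumes "0 < h" "0 < w"
  shows "polyomino (rect h w)"
proof -
  let ?C = "{c. 0 \<le> fst c \<and> fst c < int w \<and> 0 \<le> snd c \<and> snd c < int h}"
  have "?C = {0..<int w} \<times> {0..<int h}" by auto
  then have fin: "finite ?C" by simp
  have "(0, 0) \<in> ?C" using assms by simp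
  then have ne: "?C \<noteq> {}" by blast
  have sub: "rect h w \<subseteq> (\<Union>c\<in>?C. unit_square c)"
  proof
    fix p assume "p \<in> rect h w"
    then have p: "0 \<le> fst p" "fst p \<le> real w" "0 \<le> snd p" "snd p \<le> real h"
      by (cases p, simp add: rect_def cbox_Pair_eq)+
    obtain i where i: "0 \<le> i" "i < int w" "of_int i \<le> fst p" "fst p \<le> of_int i + 1"
      using unit_interval_cover[OF assms(2) p(1,2)] .
    obtain j where j: "0 \<le> j" "j < int h" "of_int j \<le> snd p" "snd p \<le> of_int j + 1"
      using unit_interval_cover[OF assms(1) p(3,4)] .
    have "p \<in> unit_square (i, j)"
      using i j by (cases p) (simp add: unit_square_def cbox_Pair_eq)
    then show "p \<in> (\<Union>c\<in>?C. unit_square c)" using i j by auto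
  qed
  have sup: "unit_square c \<subseteq> rect h w" if "c \<in> ?C" for c
  proof -
    have "of_int (fst c) + 1 \<le> real w" "of_int (snd c) + 1 \<le> real h"
      "0 \<le> real_of_int (fst c)" "0 \<le> real_of_int (snd c)"
      using that by (simp; linarith)+
    then show ?thesis
      by (auto simp: unit_square_def rect_def cbox_Pair_eq)
  qed
  have "(\<Union>c\<in>?C. unit_square c) = rect h w" using sub sup by blast
  then have "rect h w = (+) 0 ` (\<Union>c\<in>?C. unit_square c)" by simp
  then show ?thesis
    unfolding polyomino_def using fin ne edge_connected_grid[of w h] by blast
qed

end

theory Submission imports Defs begin

text \<open>
  Rotations identify all placements of the tile, so up to rearrangement a tiling of
  \<open>R\<^bsub>n\<times>m\<^esub>\<close> is determined by its number of tiles, that is, by its area. Hence a tiling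
  of width \<open>m = m' + m''\<close> admits a subtiling as soon as the widths \<open>m'\<close> and \<open>m''\<close> are
  tileable. The tileable widths form an additive subsemigroup of the positive integers; such a
  semigroup is finitely generated, so all its large elements are decomposable.
\<close>

section \<open>Additive semigroups of positive integers\<close>

text \<open>Fix some \<open>s\<close> in \<open>S\<close> and take the least element of
  \<open>S\<close> in each residue class modulo \<open>s\<close>. An element above all these minima
  exceeds the minimum of its own class by a positive multiple of \<open>s\<close>, and that multiple
  lies in \<open>S\<close> too.\<close>

lemma add_closed_eventually_decomposable:
  fixes S :: "nat set"
  assumes pos: "\<And>x. x \<in> S \<Longrightarrow> x > 0"
    and add: "\<And>x y. x \<in> S \<Longrightarrow> y \<in> S \<Longrightarrow> x + y \<in> S"
  shows "\<exists>N. \<forall>m\<in>S. m > N \<longrightarrow> (\<exists>x\<in>S. \<exists>y\<in>S. m = x + y)"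
proof (cases "S = {}")
  case False
  then obtain s where s: "s \<in> S" "s > 0" using pos by blast
  have mult: "Suc k * s \<in> S" for k
    by (induction k) (use s add in auto)
  define f where "f r = (LEAST m. m \<in> S \<and> m mod s = r)" for r
  \<comment> \<open>For a residue class that misses \<open>S\<close>, \<open>f\<close> has an
    unspecified value. This is harmless: it can only change the bound, and the class of
    \<open>m\<close> does meet \<open>S\<close>.\<close>
  have "\<exists>x\<in>S. \<exists>y\<in>S. m = x + y" if m: "m \<in> S" "m > Max (f ` {..<s})" for m
  proof -
    let ?x = "f (m mod s)"
    have x: "?x \<in> S" "?x mod s = m mod s"
      using LeastI[of "\<lambda>k. k \<in> S \<and> k mod s = m mod s" m] m by (auto simp: f_def)
    have "?x \<le> Max (f ` {..<s})"
      by (rule Max_ge) (use s in auto)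
    with m have less: "?x < m" by simp
    then have "s dvd m - ?x"
      using x(2) by (metis less_imp_le mod_eq_dvd_iff_nat)
    then obtain k where "m - ?x = k * s"
      by (metis dvd_def mult.commute)
    with less have k: "m = ?x + k * s" by simp
    \<comment> \<open>Strictness excludes \<open>k = 0\<close>, so that the second summand is a
      genuine element of \<open>S\<close>.\<close>
    with less obtain j where "k = Suc j" by (cases k) auto
    with k x mult show ?thesis by metis
  qed
  then show ?thesis by blast
qed simp

section \<open>Matchings between multisets\<close>

text \<open>Every pairing of equally long enumerations is a matching. This reduces a rearrangement
  of mutually congruent tiles to a comparison of sizes.\<close>

lemma rel_mset_total:
  assumes "size S = size T" "\<And>x y. x \<in># S \<Longrightarrow> y \<in># T \<Longrightarrow> R x y"
  shows "rel_mset R S T"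
proof -
  obtain xs ys where "mset xs = S" "mset ys = T" by (meson ex_mset)
  moreover from this have "list_all2 R xs ys"
    using assms by (auto simp: list_all2_conv_all_nth)
  ultimately show ?thesis unfolding rel_mset_def by blast
qed

lemma rel_mset_imp_left_ex:
  assumes "rel_mset R S T" "y \<in># T"
  shows "\<exists>x. x \<in># S \<and> R x y"
  using assms by (force simp: rel_mset_def list_all2_conv_all_nth in_set_conv_nth)

lemma pairwise_UnI:
  assumes "pairwise R A" "pairwise R B"
    and "\<And>x y. x \<in> A \<Longrightarrow> y \<in> B \<Longrightarrow> R x y" "\<And>x y. x \<in> A \<Longrightarrow> y \<in> B \<Longrightarrow> R y x"
  shows "pairwise R (A \<union> B)"
  using assms by (auto simp: pairwise_def)

section \<open>Boxes under rotation, reflection and translation\<close>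

lemma rot90_cbox: "rot90 ` cbox (x, y) (x', y') = cbox (- y', x) (- y, x')"
proof -
  have "p \<in> rot90 ` cbox (x, y) (x', y')" if "p \<in> cbox (- y', x) (- y, x')" for p
    by (rule image_eqI[of _ _ "(snd p, - fst p)"])
      (use that in \<open>cases p; auto simp: rot90_def cbox_Pair_eq\<close>)+
  then show ?thesis by (auto simp: rot90_def cbox_Pair_eq)
qed

lemma reflect_cbox: "reflect ` cbox (x, y) (x', y') = cbox (- x', y) (- x, y')"
proof -
  have "p \<in> reflect ` cbox (x, y) (x', y')" if "p \<in> cbox (- x', y) (- x, y')" for p
    by (rule image_eqI[of _ _ "(- fst p, snd p)"])
      (use that in \<open>cases p; auto simp: reflect_def cbox_Pair_eq\<close>)+
  then show ?thesis by (auto simp: reflect_def cbox_Pair_eq)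
qed

lemma translate_cbox:
  fixes x y :: real
  shows "(+) (u, v) ` cbox (x, y) (x', y') = cbox (u + x, v + y) (u + x', v + y')"
  using cbox_translation[of "(u, v)" "(x, y)" "(x', y')"] by simp

lemma translate_of_cbox:
  fixes x y :: real
  shows "translate_of (cbox (x, y) (x + w, y + h)) (cbox (x', y') (x' + w, y' + h))"
  unfolding translate_of_def
  by (rule exI[of _ "(x' - x, y' - y)"]) (simp only: translate_cbox, simp)

section \<open>Placed copies of the rectangle\<close>

text \<open>The corner is an arbitrary real point, since a tiling need not follow the integer
  grid.\<close>

definition placed :: "nat \<Rightarrow> nat \<Rightarrow> region \<Rightarrow> bool" where
  "placed h w P \<longleftrightarrow> (\<exists>x y. P = cbox (x, y) (x + real w, y + real h))"

definition tile :: "nat \<Rightarrow> nat \<Rightarrow> region \<Rightarrow> bool" where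
  "tile a b P \<longleftrightarrow> placed a b P \<or> placed b a P"

lemma placed_rect: "placed h w (rect h w)"
  unfolding placed_def rect_def by (intro exI[of _ 0]) simp

lemma placed_translate:
  assumes "placed h w P"
  shows "placed h w ((+) v ` P)"
proof -
  obtain x y where "P = cbox (x, y) (x + real w, y + real h)"
    using assms by (auto simp: placed_def)
  then have "(+) v ` P = cbox (fst v + x, snd v + y) (fst v + x + real w, snd v + y + real h)"
    by (cases v) (simp only: translate_cbox fst_conv snd_conv add.assoc)
  then show ?thesis unfolding placed_def by blast
qed

lemma placed_rot90:
  assumes "placed h w P"
  shows "placed w h (rot90 ` P)"
proof -
  obtain x y where "P = cbox (x, y) (x + real w, y + real h)"
    using assms by (auto simp: placed_def)
  then have "rot90 ` P = cbox (- (y + real h), x) (- (y + real h) + real h, x + real w)"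
    by (simp add: rot90_cbox)
  then show ?thesis unfolding placed_def by blast
qed

lemma placed_reflect:
  assumes "placed h w P"
  shows "placed h w (reflect ` P)"
proof -
  obtain x y where "P = cbox (x, y) (x + real w, y + real h)"
    using assms by (auto simp: placed_def)
  then have "reflect ` P = cbox (- (x + real w), y) (- (x + real w) + real w, y + real h)"
    by (simp add: reflect_cbox)
  then show ?thesis unfolding placed_def by blast
qed

lemma placed_translate_of:
  assumes "placed h w P" "placed h w Q"
  shows "translate_of P Q"
  using assms translate_of_cbox unfolding placed_def by blast

lemma tile_translate: "tile a b P \<Longrightarrow> tile a b ((+) v ` P)"
  unfolding tile_def using placed_translate by blast

lemma tile_rot90_funpow: "tile a b P \<Longrightarrow> tile a b ((rot90 ^^ k) ` P)"
proof (induction k)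
  case (Suc k)
  then have "tile a b (rot90 ` (rot90 ^^ k) ` P)"
    by (auto simp only: tile_def intro: placed_rot90)
  then show ?case by (simp add: image_comp)
qed simp

text \<open>Reflecting a rectangle yields a translate of it, so reflections add no shape beyond the
  two obtained by rotation.\<close>

lemma tile_orientations:
  assumes "Q \<in> orientations {rect a b}"
  shows "tile a b Q"
proof -
  have "tile a b (rect a b)" "tile a b (reflect ` rect a b)"
    by (simp_all add: tile_def placed_rect placed_reflect)
  then show ?thesis
    using assms tile_rot90_funpow unfolding orientations_def by blast
qed

text \<open>If both have the same orientation a translation suffices; otherwise one quarter turn
  first exchanges height and width. This makes all tiles interchangeable in a rearrangement.\<close>

lemma tile_rotated_copy:
  assumes "tile a b P" "tile a b Q"
  shows "rotated_copy P Q"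
proof -
  have "translate_of ((rot90 ^^ 0) ` P) Q \<or> translate_of ((rot90 ^^ 1) ` P) Q"
    using assms placed_translate_of placed_rot90 unfolding tile_def by (simp) blast
  then show ?thesis unfolding rotated_copy_def by blast
qed

lemma polyomino_translate:
  assumes "polyomino P"
  shows "polyomino ((+) v ` P)"
proof -
  obtain C u where C: "finite C" "C \<noteq> {}" "edge_connected C"
    "P = (+) u ` (\<Union>c\<in>C. unit_square c)"
    using assms unfolding polyomino_def by blast
  then have "(+) v ` P = (+) (v + u) ` (\<Union>c\<in>C. unit_square c)"
    using translation_assoc[of v u] by (simp only: add.commute[of u v])
  with C show ?thesis unfolding polyomino_def by blast
qed

lemma polyomino_tile:
  assumes "a > 0" "b > 0" "tile a b P"
  shows "polyomino P"
proof -
  have "polyomino P" if "placed h w P" "h > 0" "w > 0" for h w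
    using placed_translate_of[OF placed_rect that(1)] polyomino_rect[OF that(2,3)]
      polyomino_translate unfolding translate_of_def by blast
  then show ?thesis using assms unfolding tile_def by blast
qed

lemma convex_tile: "tile a b P \<Longrightarrow> convex P"
  by (auto simp: tile_def placed_def)

lemma lmeasurable_tile: "tile a b P \<Longrightarrow> P \<in> lmeasurable"
  by (auto simp: tile_def placed_def)

lemma measure_placed: "placed h w P \<Longrightarrow> measure lebesgue P = real h * real w"
  by (auto simp: placed_def content_Pair)

lemma measure_tile: "tile a b P \<Longrightarrow> measure lebesgue P = real a * real b"
  by (auto simp: tile_def measure_placed)

section \<open>Tilings as sets of placed rectangles\<close>

text \<open>The multiset of polyominoes is dropped from \<open>tiling\<close>: as all tiles are
  rotated copies of each other, the placed pieces alone carry the relevant information.\<close>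

definition tile_set :: "nat \<Rightarrow> nat \<Rightarrow> region \<Rightarrow> region set \<Rightarrow> bool" where
  "tile_set a b R X \<longleftrightarrow> finite X \<and> (\<forall>P\<in>X. tile a b P) \<and> \<Union>X = R \<and>
     pairwise (\<lambda>P Q. interior (P \<inter> Q) = {}) X"

lemma tile_set_if_tiling:
  assumes "tiling R T X" and T: "\<And>P. P \<in># T \<Longrightarrow> tile a b P"
  shows "tile_set a b R X"
proof -
  have fin: "finite X" and rel: "rel_mset translate_of T (mset_set X)"
    using assms(1) by (auto simp: tiling_def)
  have "tile a b P" if "P \<in> X" for P
  proof -
    have "P \<in># mset_set X" using that fin by simp
    from rel_mset_imp_left_ex[OF rel this] show ?thesis
      using T tile_translate unfolding translate_of_def by blast
  qed
  then show ?thesis using assms(1) by (simp add: tile_set_def tiling_def)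
qed

text \<open>Each placed piece serves as its own representative, matched by the zero
  translation.\<close>

lemma tiling_if_tile_set:
  assumes "a > 0" "b > 0" "tile_set a b R X"
  shows "tiling R (mset_set X) X"
proof -
  have "translate_of P P" for P
    unfolding translate_of_def by (rule exI[of _ 0]) simp
  then have "rel_mset translate_of (mset_set X) (mset_set X)"
    by (intro multiset.rel_refl)
  then show ?thesis
    using assms polyomino_tile by (auto simp: tiling_def tile_set_def)
qed

text \<open>Comparing areas gives the count. Lebesgue measure replaces a count of cells because
  tiles may lie off the grid.\<close>

lemma card_tile_set:
  assumes "tile_set a b (rect n m) X"
  shows "card X * (a * b) = n * m"
proof -
  have fin: "finite X" and tile: "\<And>P. P \<in> X \<Longrightarrow> tile a b P" and un: "\<Union>X = rect n m"
    and pw: "pairwise (\<lambda>P Q. interior (P \<inter> Q) = {}) X"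
    using assms by (auto simp: tile_set_def)
  \<comment> \<open>An intersection of tiles is convex, and a convex set with empty interior is a
    null set.\<close>
  have "pairwise (\<lambda>P Q. negligible (P \<inter> Q)) X"
    using pw tile
    by (simp add: pairwise_def negligible_convex_interior convex_Int convex_tile[of a b])
  then have "measure lebesgue (\<Union>X) = sum (measure lebesgue) X"
    using fin tile lmeasurable_tile by (intro measure_negligible_finite_Union) auto
  also have "\<dots> = (\<Sum>P\<in>X. real a * real b)"
    by (rule sum.cong) (use tile measure_tile in auto)
  finally have "real (card X * (a * b)) = real (n * m)"
    by (simp add: un measure_placed[OF placed_rect])
  then show ?thesis by (simp only: of_nat_eq_iff)
qed

text \<open>This is the closure of the tileable widths under addition. Tiles from different sides
  can meet only on the common vertical edge.\<close>

lemma tile_set_juxtapose: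
  assumes Y1: "tile_set a b (rect n m1) Y1" and Y2: "tile_set a b (rect n m2) Y2"
  shows "tile_set a b (rect n (m1 + m2)) (Y1 \<union> (\<lambda>P. (+) (real m1, 0) ` P) ` Y2)"
proof -
  let ?s = "(+) (real m1, 0::real)"
  let ?Z = "(\<lambda>P. ?s ` P) ` Y2"
  have U1: "\<Union>Y1 = rect n m1" and U2: "\<Union>?Z = ?s ` rect n m2"
    using Y1 Y2 by (simp_all add: tile_set_def flip: image_Union)
  have "rect n m1 \<union> ?s ` rect n m2 = rect n (m1 + m2)"
    by (simp only: rect_def translate_cbox) (auto simp: cbox_Pair_eq)
  with U1 U2 have union: "\<Union>(Y1 \<union> ?Z) = rect n (m1 + m2)" by simp
  have cross: "interior (P \<inter> Q) = {}" if "P \<in> Y1" "Q \<in> ?Z" for P Q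
  proof -
    have "P \<subseteq> rect n m1" "Q \<subseteq> ?s ` rect n m2"
      using that U1 U2 by blast+
    then have "P \<inter> Q \<subseteq> rect n m1 \<inter> ?s ` rect n m2" by blast
    \<comment> \<open>The box has width zero, hence empty interior.\<close>
    also have "\<dots> \<subseteq> cbox (real m1, 0) (real m1, real n)"
      by (simp only: rect_def translate_cbox) (auto simp: cbox_Pair_eq)
    finally have "interior (P \<inter> Q) \<subseteq> interior (cbox (real m1, 0) (real m1, real n))"
      by (rule interior_mono)
    also have "\<dots> = {}"
      by (simp add: interior_cbox box_eq_empty Basis_prod_def)
    finally show ?thesis by simp
  qed
  have shift: "interior (?s ` P \<inter> ?s ` Q) = ?s ` interior (P \<inter> Q)" for P Q
    by (simp flip: interior_translation add: image_Int)
  have "pairwise (\<lambda>P Q. interior (P \<inter> Q) = {}) Y1"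
    using Y1 by (simp add: tile_set_def)
  moreover have "pairwise (\<lambda>P Q. interior (P \<inter> Q) = {}) ?Z"
  proof (rule pairwise_imageI)
    fix P Q assume "P \<in> Y2" "Q \<in> Y2" "P \<noteq> Q"
    then have "interior (P \<inter> Q) = {}"
      using Y2 unfolding tile_set_def pairwise_def by blast
    then show "interior (?s ` P \<inter> ?s ` Q) = {}" by (simp only: shift image_empty)
  qed
  ultimately have "pairwise (\<lambda>P Q. interior (P \<inter> Q) = {}) (Y1 \<union> ?Z)"
    by (rule pairwise_UnI) (simp_all only: cross Int_commute)
  with union Y1 Y2 show ?thesis
    by (auto simp: tile_set_def tile_translate)
qed

text \<open>Equal areas force \<open>X\<close> and \<open>Y\<close> to have equally many tiles, and
  any bijection between them pairs rotated copies.\<close>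

lemma rearrangement_if_tile_set:
  assumes ab: "a > 0" "b > 0" and X: "tiling (rect n m) T X"
    and T: "\<And>P. P \<in># T \<Longrightarrow> tile a b P" and Y: "tile_set a b (rect n m) Y"
  shows "rearrangement (rect n m) T Y"
proof -
  have "card X * (a * b) = card Y * (a * b)"
    using card_tile_set[OF tile_set_if_tiling[OF X T]] card_tile_set[OF Y] by simp
  with ab have "card X = card Y" by simp
  moreover have "size T = card X"
    using X rel_mset_size[of translate_of T "mset_set X"] by (simp add: tiling_def)
  ultimately have "rel_mset rotated_copy T (mset_set Y)"
    using T Y by (intro rel_mset_total) (auto simp: tile_set_def intro: tile_rotated_copy)
  then show ?thesis
    using tiling_if_tile_set[OF ab Y] unfolding rearrangement_def by blast
qed

theorem theorem2p8:
  fixes a b :: nat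
  assumes "a > 0" and "b > 0"
  shows "\<forall>n::nat. noetherian n (orientations {rect a b})"
proof
  fix n :: nat
  let ?L = "orientations {rect a b}"
  \<comment> \<open>Positivity later supplies the nonzero widths that a subtiling requires. If no
    width is tileable, \<open>?S\<close> is empty and any bound works.\<close>
  let ?S = "{m. m > 0 \<and> (\<exists>X. tile_set a b (rect n m) X)}"
  have "\<exists>N. \<forall>m\<in>?S. m > N \<longrightarrow> (\<exists>x\<in>?S. \<exists>y\<in>?S. m = x + y)"
  proof (rule add_closed_eventually_decomposable)
    fix x y assume "x \<in> ?S" "y \<in> ?S"
    then obtain X Y where "x > 0" "tile_set a b (rect n x) X" "tile_set a b (rect n y) Y"
      by auto
    from this(1) tile_set_juxtapose[OF this(2,3)] show "x + y \<in> ?S" by auto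
  qed simp
  then obtain N where N: "\<forall>m\<in>?S. m > N \<longrightarrow> (\<exists>x\<in>?S. \<exists>y\<in>?S. m = x + y)" ..
  have "admits_subtiling n m T"
    if "m > N" and X: "tiling (rect n m) T X" and "drawn_from T ?L" for m T X
  proof -
    have T: "tile a b P" if "P \<in># T" for P
    proof -
      from that \<open>drawn_from T ?L\<close> obtain Q where Q: "Q \<in> ?L" "translate_of Q P"
        unfolding drawn_from_def by blast
      from Q(2) obtain v where "P = (+) v ` Q"
        unfolding translate_of_def ..
      with tile_translate[OF tile_orientations[OF Q(1)]] show ?thesis by simp
    qed
    have "tile_set a b (rect n m) X" by (rule tile_set_if_tiling[OF X T])
    with \<open>m > N\<close> have "m \<in> ?S" by auto
    with N \<open>m > N\<close> have "\<exists>x\<in>?S. \<exists>y\<in>?S. m = x + y" by blast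
    then obtain m1 m2 Y1 Y2 where m: "m = m1 + m2" "m1 \<noteq> 0" "m2 \<noteq> 0"
      and Y: "tile_set a b (rect n m1) Y1" "tile_set a b (rect n m2) Y2"
      by auto
    \<comment> \<open>\<open>Y1\<close> and \<open>Y2\<close> are chosen independently of
      \<open>X\<close>; only the number of tiles ties \<open>?Y\<close> to it.\<close>
    let ?Y = "Y1 \<union> (\<lambda>P. (+) (real m1, 0) ` P) ` Y2"
    have "rearrangement (rect n m) T ?Y"
      by (rule rearrangement_if_tile_set[OF assms X T])
        (use tile_set_juxtapose[OF Y] m(1) in simp_all)
    moreover have "juxtaposed n m1 m2 ?Y"
      using tiling_if_tile_set[OF assms] Y unfolding juxtaposed_def by blast
    ultimately show ?thesis
      using m unfolding admits_subtiling_def by blast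
  qed
  \<comment> \<open>One admissible bound is enough: it lies in the set whose infimum is
    \<open>betaR\<close>, so that infimum is finite.\<close>
  then have "betaR n ?L \<le> enat N"
    unfolding betaR_def by (intro Inf_lower) blast
  then show "noetherian n ?L"
    unfolding noetherian_def by (rule order_le_less_trans) simp
qed

end
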